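(* For all integers $n\geq 3$ and every $\lambda>-\frac{1}{2}$, the best constant $c_n(\lambda)$ in the Markov inequality $$\Vert p'\Vert_{w_\lambda}\leq c_n(\lambda)\,\Vert p\Vert_{w_\lambda},\qquad p\in\mathcal{P}_n,$$ satisfies $$\frac{(n+1)\big(n+\lambda+\frac{1}{2}\big)^2(n+2\lambda)}{(2\lambda+1)(2\lambda+5)}\leq c_n^2(\lambda)\leq\frac{\big(n+\frac{5}{4}\lambda+\frac{9}{8}\big)^4}{2(2\lambda+1)\sqrt{2\lambda+5}}.$$
   Context: $\mathcal{P}_n$ denotes the class of real algebraic polynomials of degree at most $n$. For $\lambda>-1/2$, $w_\lambda(t)=(1-t^2)^{\lambda-1/2}$ on $(-1,1)$ is the Gegenbauer weight and $\Vert f\Vert_{w_\lambda}=\big(\int_{-1}^1 w_\lambda(t)f^2(t)\,dt\big)^{1/2}$. The best Markov constant is $c_n(\lambda)=\sup\{\Vert p'\Vert_{w_\lambda}/\Vert p\Vert_{w_\lambda}: p\in\mathcal{P}_n,\ p\neq 0\}$. *)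

theory Defs
  imports "HOL-Analysis.Analysis" "HOL-Computational_Algebra.Polynomial"
begin

definition gegenbauer_weight :: "real \<Rightarrow> real \<Rightarrow> real" where
  "gegenbauer_weight lam t = (1 - t\<^sup>2) powr (lam - 1/2)"

definition wnorm :: "real \<Rightarrow> (real \<Rightarrow> real) \<Rightarrow> real" where
  "wnorm lam f = sqrt (LBINT t:{-1<..<1}. gegenbauer_weight lam t * (f t)\<^sup>2)"

definition markov_const :: "nat \<Rightarrow> real \<Rightarrow> real" where
  "markov_const n lam =
     (SUP p \<in> {p :: real poly. p \<noteq> 0 \<and> degree p \<le> n}.
        wnorm lam (poly (pderiv p)) / wnorm lam (poly p))"

end

theory Submission
  imports Defs
begin

text \<open>
  Put s = 2 * lam + 1. Up to normalisation the Gegenbauer polynomials are E_k = G_k - G_{k-2} with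
  G_k = C_k^{(lam+1)}, and E_k' = 2 (k + lam) G_{k-1}. Hence the Gram matrix of the derivatives of
  the normalised E_k splits by parity, and its entries 4 (k + lam) (l + lam) g_{min(k,l)-1} / sqrt (h_k h_l)
  are explicit, where g_k and h_k are the squared norms of G_k and E_k.

  The squared Markov constant is the largest eigenvalue of this matrix. It is at most the Frobenius
  norm, and passing from n - 2 to n increases the squared Frobenius norm by a polynomial in n that is
  dominated by the corresponding increment of the claimed bound. For the lower bound the test
  polynomial is the sum of k (k + 2 lam) E_k over all k \<le> n of the parity of n; both norms in its
  Rayleigh quotient have increments in closed form, and again an incremental comparison suffices.
\<close>

section \<open>Polynomial inequalities for the increments\<close>

text \<open>
  With s = 2 * lam + 1 and increment_poly s l = (l + lam) l (l + 2 lam), the sum of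
  increment_poly s k * g_{k-1} over all k \<le> l of the parity of l is g_{l-1} * partial_sum_poly s l.
\<close>

definition partial_sum_poly :: "real \<Rightarrow> real \<Rightarrow> real" where
  "partial_sum_poly s l = (l + s + 2) * (l + s + 1) * (l + s) * (l - 1) / (2 * (s + 4))
     + s * (l + s + 1) * (l + s) / (2 * (s + 2))"

definition increment_poly :: "real \<Rightarrow> real \<Rightarrow> real" where
  "increment_poly s l = (l + (s - 1) / 2) * (l * (l + s - 1))"

text \<open>Dividing by \<open>2 * s\<close> gives the claimed lower bound at degree
  \<open>l\<close>, rewritten in terms of \<open>s = 2 * lam + 1\<close>.\<close>

definition lower_poly :: "real \<Rightarrow> real \<Rightarrow> real" where
  "lower_poly s l = 2 * (l + 1) * (l + s / 2)\<^sup>2 * (l + s - 1) / (s + 4)"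

text \<open>The induction step for the test polynomial, from degree \<open>l - 2\<close> to
  \<open>l\<close>, with the common factor g_{l-1} cancelled.\<close>

lemma lower_poly_increment:
  fixes s l :: real
  assumes s: "s > 0" and l: "l \<ge> 1"
  shows "lower_poly s l * partial_sum_poly s l
             - lower_poly s (l - 2) * (partial_sum_poly s l - increment_poly s l)
           \<le> 4 * increment_poly s l * (2 * partial_sum_poly s l - increment_poly s l)"
proof -
  \<comment> \<open>Centring at the smallest admissible \<open>l\<close> makes every coefficient of
    the cleared difference \<open>Q\<close> nonnegative in \<open>t\<close> and
    \<open>s\<close>.\<close>
  define t where "t = l - 1"
  define Q where "Q = 64 * s^2 + 208 * s^3 + 240 * s^4 + 120 * s^5 + 26 * s^6 + 2 * s^7
    + t * (224 * s + 1008 * s^2 + 1608 * s^3 + 1160 * s^4 + 408 * s^5 + 71 * s^6 + 5 * s^7)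
    + t^2 * (128 + 1504 * s + 3496 * s^2 + 3612 * s^3 + 1804 * s^4 + 474 * s^5 + 61 * s^6 + 3 * s^7)
    + t^3 * (768 + 2968 * s + 4716 * s^2 + 3330 * s^3 + 1211 * s^4 + 213 * s^5 + 16 * s^6)
    + t^4 * (800 + 2520 * s + 2892 * s^2 + 1458 * s^3 + 329 * s^4 + 35 * s^5)
    + t^5 * (384 + 1208 * s + 852 * s^2 + 256 * s^3 + 42 * s^4)
    + t^6 * (224 + 200 * s + 100 * s^2 + 28 * s^3)
    + t^7 * (16 * s + 8 * s^2)"
  have Z: "partial_sum_poly s l = ((l + s + 2) * (l + s + 1) * (l + s) * (l - 1) * (s + 2)
      + s * (l + s + 1) * (l + s) * (s + 4)) / (2 * (s + 4) * (s + 2))"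
    unfolding partial_sum_poly_def using s by (simp add: divide_simps) algebra
  have "4 * increment_poly s l * (2 * partial_sum_poly s l - increment_poly s l)
      - (lower_poly s l * partial_sum_poly s l
           - lower_poly s (l - 2) * (partial_sum_poly s l - increment_poly s l))
      = Q / (4 * (s + 4)^2 * (s + 2))"
    unfolding Z increment_poly_def lower_poly_def Q_def t_def using s
    by (simp add: divide_simps) algebra
  moreover have "Q \<ge> 0"
    unfolding Q_def using s l by (intro add_nonneg_nonneg mult_nonneg_nonneg) (auto simp: t_def)
  ultimately show ?thesis using s by (smt (verit) divide_nonneg_nonneg zero_le_power mult_nonneg_nonneg)
qed

text \<open>The left side is the increment of the squared Frobenius norm times
  \<open>4 * s^2 * (s + 4)\<close>. With \<open>m = l + lam\<close> it becomes a multiple of an odd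
  polynomial of degree 7 in \<open>m\<close>, while the right side is an odd polynomial in
  \<open>m + s/8\<close>.\<close>

lemma upper_poly_increment:
  fixes s l :: real
  assumes s: "s > 0" and l: "l \<ge> 1"
  defines "Y \<equiv> \<lambda>l. l + 1/2 + 5/8 * s"
  shows "16 * (s + 4) * (increment_poly s l * (2 * partial_sum_poly s l - increment_poly s l))
    \<le> Y l ^ 8 - Y (l - 2) ^ 8"
proof -
  define m where "m = l + (s - 1) / 2"
  define a where "a = (s - 1)\<^sup>2 / 4"
  define K where "K = (s + 1) * (s + 3) * (s^3 + 4 * s^2 + s + 10) / (16 * (s + 2))"
  have m: "m \<ge> (s + 1) / 2" using l by (simp add: m_def field_simps)
  have m0: "m > 0" using m s by simp
  have d: "increment_poly s l = m * (m\<^sup>2 - a)"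
    by (simp add: increment_poly_def m_def a_def field_simps power2_eq_square)
  have "0 \<le> l * (l + s - 1)" using l s by simp
  also have "l * (l + s - 1) = m\<^sup>2 - a"
    by (simp add: m_def a_def field_simps power2_eq_square)
  finally have ma: "0 \<le> m\<^sup>2 - a" .
  have "(s + 4) * (2 * partial_sum_poly s l - increment_poly s l)
      = m^4 + ((3 * s + 7) / 2 + s * (s + 4) / (s + 2)) * m\<^sup>2 - K"
    unfolding partial_sum_poly_def increment_poly_def m_def K_def using s
    by (simp add: divide_simps) algebra
  \<comment> \<open>Drop \<open>K\<close> and use \<open>s * (s + 4) <= (s + 2)^2\<close>.\<close>
  also have "\<dots> \<le> m^4 + (5 * s + 11) / 2 * m\<^sup>2"
  proof -
    have "K \<ge> 0" using s by (simp add: K_def)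
    moreover define c where "c = s * (s + 4) / (s + 2)"
    have "c \<le> s + 2"
      using s by (simp add: c_def field_simps)
    then have "((3 * s + 7) / 2 + c) * m\<^sup>2 \<le> (5 * s + 11) / 2 * m\<^sup>2"
      by (intro mult_right_mono) (auto simp: field_simps)
    ultimately show ?thesis unfolding c_def by linarith
  qed
  finally have z: "(s + 4) * (2 * partial_sum_poly s l - increment_poly s l) \<le> m^4 + (5 * s + 11) / 2 * m\<^sup>2" .
  have "(s + 4) * (increment_poly s l * (2 * partial_sum_poly s l - increment_poly s l))
      \<le> m * (m\<^sup>2 - a) * (m^4 + (5 * s + 11) / 2 * m\<^sup>2)"
    using mult_left_mono[OF z, of "m * (m\<^sup>2 - a)"] ma m0 by (simp add: d mult_ac)
  also have "\<dots> \<le> m * m\<^sup>2 * (m^4 + (5 * s + 11) / 2 * m\<^sup>2)"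
    using m0 s by (intro mult_right_mono mult_left_mono) (auto simp: a_def)
  also have "\<dots> = m^7 + (5 * s + 11) / 2 * m^5"
    by algebra
  finally have 1: "(s + 4) * (increment_poly s l * (2 * partial_sum_poly s l - increment_poly s l))
      \<le> m^7 + (5 * s + 11) / 2 * m^5" .
  define r where "r = s / 8"
  have r: "r > 0" using s by (simp add: r_def)
  \<comment> \<open>The terms on the right are supplied by \<open>(m + r)^7\<close> and
    \<open>7 * (m + r)^5\<close>. Inserting the least value of \<open>m\<close> leaves a quadratic
    in \<open>r\<close> with positive minimum.\<close>
  have "(5 * s + 11) / 2 * m^5 \<le> (7 * r * m + 21 * r\<^sup>2 + 7) * m^5"
  proof (rule mult_right_mono)
    have "7 * r * m \<ge> 7 * r * ((s + 1) / 2)"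
      using m r by (intro mult_left_mono) auto
    moreover have "7 * r * ((s + 1) / 2) + 21 * r\<^sup>2 + 7 - (5 * s + 11) / 2 = 49 * (r - 33/196)\<^sup>2 + 87/784"
      by (simp add: r_def field_simps power2_eq_square)
    moreover have "0 \<le> 49 * (r - 33/196)\<^sup>2"
      by simp
    ultimately show "(5 * s + 11) / 2 \<le> 7 * r * m + 21 * r\<^sup>2 + 7"
      by linarith
  qed (use m0 in simp)
  also have "\<dots> = 7 * r * m^6 + 21 * r\<^sup>2 * m^5 + 7 * m^5" by algebra
  finally have "m^7 + (5 * s + 11) / 2 * m^5 \<le> m^7 + 7 * r * m^6 + 21 * r\<^sup>2 * m^5 + 7 * m^5" by simp
  also have "\<dots> \<le> (m + r)^7 + 7 * (m + r)^5 + 7 * (m + r)^3 + (m + r)"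
  proof -
    have "(m + r)^7 = m^7 + 7 * r * m^6 + 21 * r\<^sup>2 * m^5
        + (35 * r^3 * m^4 + 35 * r^4 * m^3 + 21 * r^5 * m\<^sup>2 + 7 * r^6 * m + r^7)"
      by algebra
    moreover have "0 \<le> 35 * r^3 * m^4 + 35 * r^4 * m^3 + 21 * r^5 * m\<^sup>2 + 7 * r^6 * m + r^7"
      using r m0 by simp
    moreover have "m^5 \<le> (m + r)^5"
      using r m0 by (intro power_mono) auto
    moreover have "0 \<le> 7 * (m + r)^3 + (m + r)"
      using r m0 by simp
    ultimately show ?thesis by linarith
  qed
  finally have 2: "m^7 + (5 * s + 11) / 2 * m^5
      \<le> (m + r)^7 + 7 * (m + r)^5 + 7 * (m + r)^3 + (m + r)" .
  have "Y l = (m + r) + 1" "Y (l - 2) = (m + r) - 1"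
    by (simp_all add: Y_def m_def r_def field_simps)
  then have "Y l ^ 8 - Y (l - 2) ^ 8 = 16 * ((m + r)^7 + 7 * (m + r)^5 + 7 * (m + r)^3 + (m + r))"
    by algebra
  moreover have "16 * ((s + 4) * (increment_poly s l * (2 * partial_sum_poly s l - increment_poly s l)))
      \<le> 16 * ((m + r)^7 + 7 * (m + r)^5 + 7 * (m + r)^3 + (m + r))"
    using order_trans[OF 1 2] by (intro mult_left_mono) simp_all
  ultimately show ?thesis by (simp only: mult.assoc)
qed

text \<open>The two-step recurrence of the partial sums, with g_{l+1} / g_{l-1} replaced by its
  explicit value.\<close>

lemma partial_sum_poly_step:
  assumes "s > 0"
  shows "(partial_sum_poly s (l + 2) - increment_poly s (l + 2)) * ((l + 1 + s) * (l + s))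
    = partial_sum_poly s l * ((l + 1) * l)"
  unfolding partial_sum_poly_def increment_poly_def using assms by (simp add: divide_simps) algebra

lemma partial_sum_poly_1: "s > 0 \<Longrightarrow> partial_sum_poly s 1 = increment_poly s 1"
  by (simp add: partial_sum_poly_def increment_poly_def field_simps)

section \<open>The polynomials\<close>

text \<open>
  geg lam n is the Gegenbauer polynomial with parameter lam + 1, and gegdiff lam n equals
  (n + lam) / lam times the one with parameter lam. This scaling has no singularity at lam = 0.
\<close>

fun geg :: "real \<Rightarrow> nat \<Rightarrow> real poly" where
  "geg lam 0 = 1"
| "geg lam (Suc 0) = [:0, 2 * (lam + 1):]"
| "geg lam (Suc (Suc n)) =
     smult (1 / (real n + 2)) (smult (2 * (real n + 2 + lam)) (pCons 0 (geg lam (Suc n)))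
       - smult (real n + 2 + 2 * lam) (geg lam n))"

fun gegdiff :: "real \<Rightarrow> nat \<Rightarrow> real poly" where
  "gegdiff lam (Suc (Suc n)) = geg lam (Suc (Suc n)) - geg lam n"
| "gegdiff lam n = geg lam n"

lemma degree_geg_le: "degree (geg lam n) \<le> n"
proof (induction n rule: induct_nat_012)
  case (ge2 n)
  have "degree (pCons 0 (geg lam (Suc n))) \<le> Suc (Suc n)"
    using ge2 degree_pCons_le[of 0 "geg lam (Suc n)"] by linarith
  then show ?case
    using ge2 by (auto intro!: degree_diff_le degree_smult_le[THEN order_trans])
qed auto

lemma coeff_geg_pos:
  assumes "lam > -1"
  shows "coeff (geg lam n) n > 0"
proof (induction n rule: induct_nat_012)
  case (ge2 n)
  have "coeff (geg lam n) (Suc (Suc n)) = 0"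
    using degree_geg_le[of lam n] by (intro coeff_eq_0) auto
  then show ?case using ge2 assms by (auto intro!: divide_pos_pos mult_pos_pos)
qed (use assms in auto)

lemma geg_rec:
  "(real n + 2) * poly (geg lam (Suc (Suc n))) x
     = 2 * (real n + 2 + lam) * x * poly (geg lam (Suc n)) x - (real n + 2 + 2 * lam) * poly (geg lam n) x"
  by (simp add: field_simps)

declare geg.simps(3)[simp del]

section \<open>Derivative relations and the Gegenbauer differential equation\<close>

lemma pderiv_geg_rec:
  "(real n + 2) * poly (pderiv (geg lam (Suc (Suc n)))) x
     = 2 * (real n + 2 + lam) * (poly (geg lam (Suc n)) x + x * poly (pderiv (geg lam (Suc n))) x)
       - (real n + 2 + 2 * lam) * poly (pderiv (geg lam n)) x"
  by (simp add: geg.simps(3) pderiv_pCons pderiv_smult pderiv_diff distrib_left mult.left_commute)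

text \<open>The relations are proved jointly: at the next index the second follows from the first
  and third, the third from the first and second, and the first from the differentiated recurrence
  and the new second.\<close>

lemma geg_pderiv_rels:
  "poly (pderiv (geg lam (Suc (Suc n)))) x
      = poly (pderiv (geg lam n)) x + 2 * (real n + 2 + lam) * poly (geg lam (Suc n)) x"
  "x * poly (pderiv (geg lam (Suc n))) x
      = poly (pderiv (geg lam n)) x + (real n + 1) * poly (geg lam (Suc n)) x"
  "poly (pderiv (geg lam (Suc n))) x
      = x * poly (pderiv (geg lam n)) x + (real n + 2 + 2 * lam) * poly (geg lam n) x"
proof (induction n)
  case 0
  {
    case 1
    show ?case
      using pderiv_geg_rec[of 0 lam x] by (simp add: pderiv_pCons algebra_simps)
  next
    case 2
    show ?case by (simp add: pderiv_pCons algebra_simps)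
  next
    case 3
    show ?case by (simp add: pderiv_pCons algebra_simps)
  }
next
  case (Suc n)
  let ?g = "\<lambda>k. poly (geg lam k) x" and ?d = "\<lambda>k. poly (pderiv (geg lam k)) x"
  have B: "x * ?d (Suc (Suc n)) = ?d (Suc n) + (real n + 2) * ?g (Suc (Suc n))"
    using Suc geg_rec[of n lam x] by algebra
  have "(real n + 3) * ?d (Suc (Suc (Suc n)))
      = (real n + 3) * (?d (Suc n) + 2 * (real n + 3 + lam) * ?g (Suc (Suc n)))"
    using pderiv_geg_rec[of "Suc n" lam x, simplified] B by algebra
  then have A: "?d (Suc (Suc (Suc n))) = ?d (Suc n) + 2 * (real n + 3 + lam) * ?g (Suc (Suc n))"
    by simp
  have D: "?d (Suc (Suc n)) = x * ?d (Suc n) + (real n + 3 + 2 * lam) * ?g (Suc n)"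
    using Suc by algebra
  {
    case 1
    show ?case using A by (simp add: algebra_simps)
  next
    case 2
    show ?case using B by (simp add: algebra_simps)
  next
    case 3
    show ?case using D by (simp add: algebra_simps)
  }
qed

lemma pderiv_gegdiff: "pderiv (gegdiff lam (Suc n)) = smult (2 * (real n + 1 + lam)) (geg lam n)"
proof (cases n)
  case (Suc k)
  have "poly (pderiv (gegdiff lam (Suc n))) x = poly (smult (2 * (real n + 1 + lam)) (geg lam n)) x" for x
    using geg_pderiv_rels(1)[of lam k x] by (simp add: Suc pderiv_diff algebra_simps)
  then show ?thesis by (simp add: poly_eq_poly_eq_iff[symmetric] fun_eq_iff)
qed (simp add: pderiv_pCons algebra_simps)

text \<open>Both derivatives of E_n are multiples of G_{n-1} and its derivative, so the differential
  equation reduces to the relations above and the recurrence.\<close>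

lemma gegdiff_eigen:
  "[:1, 0, -1:] * pderiv (pderiv (gegdiff lam n)) - smult (2 * lam + 1) ([:0, 1:] * pderiv (gegdiff lam n))
     = smult (- (real n * (real n + 2 * lam))) (gegdiff lam n)"
proof -
  let ?g = "\<lambda>k x. poly (geg lam k) x" and ?d = "\<lambda>k x. poly (pderiv (geg lam k)) x"
  have "(1 - x\<^sup>2) * (2 * (real n + 1 + lam) * ?d n x) - (2 * lam + 1) * x * (2 * (real n + 1 + lam) * ?g n x)
      = - ((real n + 1) * (real n + 1 + 2 * lam)) * poly (gegdiff lam (Suc n)) x" for n x
  proof (cases n)
    case 0
    then show ?thesis by (simp add: algebra_simps)
  next
    case (Suc k)
    define r where "r = real k"
    have "?d (Suc k) x = x * ?d k x + (r + 2 + 2 * lam) * ?g k x"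
         "x * ?d (Suc k) x = ?d k x + (r + 1) * ?g (Suc k) x"
         "(r + 2) * ?g (Suc (Suc k)) x = 2 * (r + 2 + lam) * x * ?g (Suc k) x - (r + 2 + 2 * lam) * ?g k x"
      using geg_pderiv_rels(2,3)[where lam=lam and n=k and x=x] geg_rec[of k lam x] by (simp_all add: r_def)
    then have "(1 - x\<^sup>2) * (2 * (r + 2 + lam) * ?d (Suc k) x) - (2 * lam + 1) * x * (2 * (r + 2 + lam) * ?g (Suc k) x)
      = - ((r + 2) * (r + 2 + 2 * lam)) * (?g (Suc (Suc k)) x - ?g k x)"
      by algebra
    then show ?thesis by (simp add: Suc r_def algebra_simps)
  qed
  then show ?thesis
    by (cases n) (auto simp: poly_eq_poly_eq_iff[symmetric] fun_eq_iff pderiv_gegdiff pderiv_smult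
        power2_eq_square algebra_simps)
qed

section \<open>Leading coefficients and expansion in the E_k\<close>

lemma coeff_gegdiff_pos:
  assumes "lam > -1"
  shows "coeff (gegdiff lam n) n > 0"
proof (cases "(lam, n)" rule: gegdiff.cases)
  case (1 l m)
  have "coeff (geg lam m) (Suc (Suc m)) = 0"
    using degree_geg_le[of lam m] by (intro coeff_eq_0) auto
  then show ?thesis using 1 coeff_geg_pos[OF assms, of n] by simp
qed (use coeff_geg_pos[OF assms, of n] in auto)

lemma degree_gegdiff_le: "degree (gegdiff lam n) \<le> n"
proof (cases "(lam, n)" rule: gegdiff.cases)
  case (1 l m)
  then show ?thesis
    using degree_geg_le[of lam n] degree_geg_le[of lam m] by (auto intro!: degree_diff_le)
qed (use degree_geg_le[of lam n] in auto)

lemma gegdiff_expansion: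
  assumes "lam > -1" "degree p \<le> n"
  shows "\<exists>a. p = (\<Sum>k\<le>n. smult (a k) (gegdiff lam k))"
  using assms(2)
proof (induction n arbitrary: p)
  case 0
  then obtain b where "p = [:b:]" by (auto elim: degree_eq_zeroE)
  then show ?case by (auto intro!: exI[of _ "\<lambda>_. b"])
next
  case (Suc n)
  define c where "c = coeff p (Suc n) / coeff (gegdiff lam (Suc n)) (Suc n)"
  have "degree (p - smult c (gegdiff lam (Suc n))) \<le> n"
  proof (rule degree_le, intro allI impI)
    fix i assume "n < i"
    show "coeff (p - smult c (gegdiff lam (Suc n))) i = 0"
    proof (cases "i = Suc n")
      case True
      then show ?thesis using coeff_gegdiff_pos[OF assms(1), of "Suc n"] by (simp add: c_def)
    next
      case False
      with \<open>n < i\<close> have "coeff p i = 0" "coeff (gegdiff lam (Suc n)) i = 0"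
        using Suc.prems degree_gegdiff_le[of lam "Suc n"] by (auto intro!: coeff_eq_0)
      then show ?thesis by simp
    qed
  qed
  then obtain a where a: "p - smult c (gegdiff lam (Suc n)) = (\<Sum>k\<le>n. smult (a k) (gegdiff lam k))"
    using Suc.IH by blast
  have "p = (\<Sum>k\<le>n. smult (a k) (gegdiff lam k)) + smult c (gegdiff lam (Suc n))"
    using a by (simp add: algebra_simps)
  also have "\<dots> = (\<Sum>k\<le>Suc n. smult ((a(Suc n := c)) k) (gegdiff lam k))"
    by simp
  finally show ?case by blast
qed

lemma pderiv_sum: "pderiv (\<Sum>i\<in>A. f i) = (\<Sum>i\<in>A. pderiv (f i))"
  by (induction A rule: infinite_finite_induct) (auto simp: pderiv_add)

section \<open>Sums over one parity class\<close>

text \<open>Cauchy-Schwarz on \<open>A \<times> A\<close>, applied to the families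
  \<open>b i * b j\<close> and \<open>M i j\<close>.\<close>

lemma quadratic_form_le_frobenius:
  fixes b :: "'a \<Rightarrow> real" and M :: "'a \<Rightarrow> 'a \<Rightarrow> real"
  assumes "(\<Sum>i\<in>A. \<Sum>j\<in>A. (M i j)\<^sup>2) \<le> C\<^sup>2" "C \<ge> 0"
  shows "(\<Sum>i\<in>A. \<Sum>j\<in>A. b i * b j * M i j) \<le> C * (\<Sum>i\<in>A. (b i)\<^sup>2)"
proof (rule power2_le_imp_le)
  have "(\<Sum>i\<in>A. \<Sum>j\<in>A. b i * b j * M i j)\<^sup>2
      = (\<Sum>(i,j)\<in>A\<times>A. b i * b j * M i j)\<^sup>2"
    by (simp add: sum.cartesian_product)
  also have "\<dots> \<le> (\<Sum>(i,j)\<in>A\<times>A. (b i * b j)\<^sup>2) * (\<Sum>(i,j)\<in>A\<times>A. (M i j)\<^sup>2)"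
    using Cauchy_Schwarz_ineq_sum[of "\<lambda>(i,j). b i * b j" "\<lambda>(i,j). M i j" "A \<times> A"]
    by (simp add: case_prod_unfold)
  also have "(\<Sum>(i,j)\<in>A\<times>A. (b i * b j)\<^sup>2) = (\<Sum>i\<in>A. (b i)\<^sup>2)\<^sup>2"
    by (simp add: sum.cartesian_product[symmetric] power2_eq_square sum_product mult_ac)
  also have "(\<Sum>i\<in>A. (b i)\<^sup>2)\<^sup>2 * (\<Sum>(i,j)\<in>A\<times>A. (M i j)\<^sup>2) \<le> (\<Sum>i\<in>A. (b i)\<^sup>2)\<^sup>2 * C\<^sup>2"
    using assms(1) by (intro mult_left_mono) (simp_all add: sum.cartesian_product)
  finally show "(\<Sum>i\<in>A. \<Sum>j\<in>A. b i * b j * M i j)\<^sup>2 \<le> (C * (\<Sum>i\<in>A. (b i)\<^sup>2))\<^sup>2"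
    by (simp add: power_mult_distrib mult.commute)
  show "0 \<le> C * (\<Sum>i\<in>A. (b i)\<^sup>2)"
    using assms(2) by (simp add: sum_nonneg)
qed

text \<open>Index \<open>i\<close> stands for E_{i+1}, whose derivative is a multiple of G_i; the
  set thus collects the degrees from 1 to \<open>n\<close> with the parity of
  \<open>n\<close>.\<close>

definition parity_below :: "nat \<Rightarrow> nat set" where
  "parity_below n = {i. i < n \<and> odd (i + n)}"

lemma parity_below_simps [simp]:
  "parity_below 0 = {}"
  "parity_below (Suc 0) = {0}"
  "parity_below (Suc (Suc n)) = insert (Suc n) (parity_below n)"
  by (auto simp: parity_below_def less_Suc_eq)

lemma finite_parity_below [simp]: "finite (parity_below n)"
  by (simp add: parity_below_def)

lemma not_in_parity_below [simp]: "Suc n \<notin> parity_below n"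
  by (simp add: parity_below_def)

lemma parity_below_Un: "{..<Suc n} = parity_below (Suc n) \<union> parity_below n"
  "parity_below (Suc n) \<inter> parity_below n = {}"
  by (auto simp: parity_below_def less_Suc_eq)

text \<open>A symmetric matrix is bordered by one row and one column: a new diagonal entry plus the
  new column counted twice.\<close>

lemma sum_sum_parity_below_Suc_Suc:
  fixes f :: "nat \<Rightarrow> nat \<Rightarrow> real"
  assumes "\<And>i j. f i j = f j i"
  shows "(\<Sum>i\<in>parity_below (Suc (Suc n)). \<Sum>j\<in>parity_below (Suc (Suc n)). f i j)
     = (\<Sum>i\<in>parity_below n. \<Sum>j\<in>parity_below n. f i j)
       + f (Suc n) (Suc n) + 2 * (\<Sum>i\<in>parity_below n. f i (Suc n))"
proof -
  have "(\<Sum>j\<in>parity_below n. f (Suc n) j) = (\<Sum>i\<in>parity_below n. f i (Suc n))"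
    by (intro sum.cong refl assms)
  then show ?thesis by (simp add: sum.distrib)
qed

section \<open>Orthogonality and norms\<close>

text \<open>An algebraic abstraction of the weighted integral. \<open>L_by_parts\<close> says that
  the derivative of \<open>(1 - t^2) powr (lam + 1/2) * f\<close> integrates to zero; orthogonality
  and all norms follow from it.\<close>

locale gegenbauer_functional =
  fixes lam :: real and L :: "real poly \<Rightarrow> real"
  assumes lam: "lam > -1/2"
    and L_add: "L (p + q) = L p + L q"
    and L_smult: "L (smult c p) = c * L p"
    and L_1_pos: "L 1 > 0"
    and L_by_parts: "L ([:1, 0, -1:] * pderiv f - smult (2 * lam + 1) ([:0, 1:] * f)) = 0"
begin

abbreviation G :: "nat \<Rightarrow> real poly" where "G \<equiv> geg lam"
abbreviation E :: "nat \<Rightarrow> real poly" where "E \<equiv> gegdiff lam"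
abbreviation g :: "nat \<Rightarrow> real" where "g n \<equiv> L (G n * G n)"
abbreviation h :: "nat \<Rightarrow> real" where "h n \<equiv> L (E n * E n)"
abbreviation X :: "nat \<Rightarrow> real" where "X n \<equiv> real n * (real n + 2 * lam)"

definition s :: real where "s = 2 * lam + 1"

lemma s_pos: "s > 0"
  using lam by (simp add: s_def)

lemma L_diff: "L (p - q) = L p - L q"
  using L_add[of "p - q" q] by simp

lemma L_0 [simp]: "L 0 = 0"
  using L_diff[of 0 0] by simp

lemma L_sum: "L (\<Sum>i\<in>A. f i) = (\<Sum>i\<in>A. L (f i))"
  by (induction A rule: infinite_finite_induct) (auto simp: L_add)

lemma L_square_sum:
  "L ((\<Sum>i\<in>A. smult (c i) (f i)) * (\<Sum>i\<in>A. smult (c i) (f i)))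
    = (\<Sum>i\<in>A. \<Sum>j\<in>A. c i * c j * L (f i * f j))"
  by (auto simp: sum_product L_sum L_smult intro!: sum.cong)

text \<open>Integration by parts with \<open>f = pderiv p * q\<close>. The right side is symmetric
  in \<open>p\<close> and \<open>q\<close>, so the differential operator is self-adjoint.\<close>

lemma L_sturm_liouville:
  "L (q * ([:1, 0, -1:] * pderiv (pderiv p) - smult (2 * lam + 1) ([:0, 1:] * pderiv p)))
     = - L ([:1, 0, -1:] * (pderiv p * pderiv q))"
proof -
  have "[:1, 0, -1:] * pderiv (pderiv p * q) - smult (2 * lam + 1) ([:0, 1:] * (pderiv p * q))
    = q * ([:1, 0, -1:] * pderiv (pderiv p) - smult (2 * lam + 1) ([:0, 1:] * pderiv p))
      + [:1, 0, -1:] * (pderiv p * pderiv q)"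
    by (simp add: poly_eq_poly_eq_iff[symmetric] fun_eq_iff pderiv_mult algebra_simps)
  then show ?thesis
    using L_by_parts[of "pderiv p * q"] by (simp only: L_add)
qed

lemma X_strict_mono: "j < k \<Longrightarrow> X j < X k"
proof -
  assume "j < k"
  \<comment> \<open>Here \<open>j < k\<close> gives \<open>j + k >= 1\<close>, which together with
    \<open>2 * lam > -1\<close> makes the second factor positive.\<close>
  then have "(real k - real j) * (real j + real k + 2 * lam) > 0"
    using lam by (intro mult_pos_pos) auto
  then show ?thesis by (simp add: algebra_simps)
qed

text \<open>Eigenvectors of a self-adjoint operator with distinct eigenvalues.\<close>

lemma E_orthogonal:
  assumes "j \<noteq> k"
  shows "L (E j * E k) = 0"
proof -
  have "L (E j * smult (- X k) (E k)) = L (E k * smult (- X j) (E j))"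
    using L_sturm_liouville[of "E j" "E k"] L_sturm_liouville[of "E k" "E j"]
    unfolding gegdiff_eigen by (simp only: mult.commute)
  then have "X k * L (E j * E k) = X j * L (E j * E k)"
    by (simp only: mult_smult_right L_smult mult.commute[of "E k" "E j"]) simp
  moreover have "X j \<noteq> X k"
    using assms X_strict_mono[of j k] X_strict_mono[of k j] by (cases j k rule: linorder_cases) auto
  ultimately show ?thesis by (metis mult_right_cancel)
qed

lemma G_Suc_Suc: "G (Suc (Suc n)) = G n + E (Suc (Suc n))"
  by simp

text \<open>G_j is the sum of E_j, E_{j-2}, and so on, so E_m can meet only a G_j of the same parity
  with \<open>m <= j\<close>.\<close>

lemma L_E_G:
  assumes "j < m \<or> odd (m + j)"
  shows "L (E m * G j) = 0"
  using assms
proof (induction j rule: induct_nat_012)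
  case 0
  then show ?case using E_orthogonal[of m 0] by (cases m) auto
next
  case 1
  then show ?case using E_orthogonal[of m 1] by (cases "m = 1") auto
next
  case (ge2 j)
  then show ?case using E_orthogonal[of m "Suc (Suc j)"]
    by (cases "m = Suc (Suc j)") (auto simp: G_Suc_Suc distrib_left L_add simp del: gegdiff.simps)
qed

text \<open>Raising the larger index by 2 adds an E of index above \<open>i\<close>, which is
  orthogonal to G_i; the value depends only on the smaller index.\<close>

lemma L_G_G_same_parity: "L (G i * G (i + 2 * k)) = g i"
proof (induction k)
  case (Suc k)
  have "L (G i * E (Suc (Suc (i + 2 * k)))) = 0"
    using L_E_G[of i "Suc (Suc (i + 2 * k))"] by (simp add: mult.commute del: gegdiff.simps)
  then show ?case
    using Suc by (simp add: G_Suc_Suc distrib_left L_add del: gegdiff.simps)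
qed simp

lemma L_G_G:
  assumes "i \<le> j" "even (i + j)"
  shows "L (G i * G j) = g i" "L (G j * G i) = g i"
proof -
  from assms obtain k where "j = i + 2 * k"
    by (metis add_diff_inverse_nat dvdE even_diff_nat not_less add.commute)
  then show "L (G i * G j) = g i" "L (G j * G i) = g i"
    using L_G_G_same_parity[of i k] by (simp_all add: mult.commute)
qed

lemma L_G_G_Suc_Suc: "L (G i * G (Suc (Suc i))) = g i" "L (G (Suc (Suc i)) * G i) = g i"
  by (rule L_G_G; simp)+

lemma L_G_G_odd: "odd (i + j) \<Longrightarrow> L (G i * G j) = 0"
proof (induction i rule: induct_nat_012)
  case 0
  then show ?case using L_E_G[of j 0] by simp
next
  case 1
  then show ?case using L_E_G[of j 1] by simp
next
  case (ge2 i)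
  then show ?case using L_E_G[of j "Suc (Suc i)"]
    by (simp add: G_Suc_Suc distrib_right L_add del: gegdiff.simps)
qed

section \<open>Recurrences for the squared norms\<close>

lemma pCons_G:
  "smult (2 * (real n + 2 + lam)) (pCons 0 (G (Suc n)))
     = smult (real n + 2) (G (Suc (Suc n))) + smult (real n + 2 + 2 * lam) (G n)"
  by (simp add: geg.simps(3))

text \<open>The value of \<open>L\<close> on t G_{n+2} G_{n+1} is computed twice, by expanding t
  G_{n+2} and by expanding t G_{n+1} with the recurrence.\<close>

lemma g_Suc: "(real n + 1) * g (Suc n) = (real n + 2 + 2 * lam) * g n"
proof (induction n)
  case 0
  \<comment> \<open>Integration by parts with f = t yields the second moment.\<close>
  have "[:1, 0, -1:] * pderiv [:0, 1:] - smult (2 * lam + 1) ([:0, 1:] * [:0, 1:])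
      = 1 - smult (2 * lam + 2) [:0, 0, 1 :: real:]"
    by (simp add: poly_eq_poly_eq_iff[symmetric] fun_eq_iff pderiv_pCons algebra_simps)
  with L_by_parts[of "[:0, 1:]"] have "L (1 - smult (2 * lam + 2) [:0, 0, 1:]) = 0"
    by metis
  then have "(2 * lam + 2) * L [:0, 0, 1:] = L 1"
    by (simp only: L_diff L_smult)
  moreover have "G (Suc 0) * G (Suc 0) = smult (4 * (lam + 1)\<^sup>2) [:0, 0, 1:]"
    by (simp add: power2_eq_square algebra_simps)
  ultimately have "g (Suc 0) = 4 * (lam + 1)\<^sup>2 * L [:0, 0, 1:]" "(2 * lam + 2) * L [:0, 0, 1:] = L 1"
    by (simp_all only: L_smult)
  then have "g (Suc 0) = 2 * (lam + 1) * L 1" by algebra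
  then show ?case by simp
next
  case (Suc n)
  have "2 * (real n + 3 + lam) * L (pCons 0 (G (Suc (Suc n))) * G (Suc n))
      = L (smult (2 * (real (Suc n) + 2 + lam)) (pCons 0 (G (Suc (Suc n)))) * G (Suc n))"
    by (simp only: mult_smult_left L_smult of_nat_Suc) (simp add: algebra_simps)
  also have "\<dots> = (real n + 3) * g (Suc n) + (real n + 3 + 2 * lam) * g (Suc n)"
    unfolding pCons_G by (simp add: distrib_right L_add L_smult L_G_G_Suc_Suc del: mult_pCons_left)
  finally have "2 * (real n + 3 + lam) * (L (pCons 0 (G (Suc (Suc n))) * G (Suc n)) - g (Suc n)) = 0"
    by (simp only: right_diff_distrib) (simp add: algebra_simps)
  then have "L (pCons 0 (G (Suc (Suc n))) * G (Suc n)) = g (Suc n)"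
    using lam by (simp del: mult_pCons_left)
  moreover have "pCons 0 (G (Suc (Suc n))) * G (Suc n) = pCons 0 (G (Suc n)) * G (Suc (Suc n))"
    by simp
  moreover have "2 * (real n + 2 + lam) * L (pCons 0 (G (Suc n)) * G (Suc (Suc n)))
      = L (smult (2 * (real n + 2 + lam)) (pCons 0 (G (Suc n))) * G (Suc (Suc n)))"
    by (simp only: mult_smult_left L_smult)
  moreover have "\<dots> = (real n + 2) * g (Suc (Suc n)) + (real n + 2 + 2 * lam) * g n"
    unfolding pCons_G by (simp add: distrib_right L_add L_smult L_G_G_Suc_Suc del: mult_pCons_left)
  ultimately have "2 * (real n + 2 + lam) * g (Suc n) = (real n + 2) * g (Suc (Suc n)) + (real n + 2 + 2 * lam) * g n"
    by metis
  with Suc show ?case by (simp add: algebra_simps)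
qed

lemma g_pos: "g n > 0"
proof (induction n)
  case 0
  show ?case using L_1_pos by simp
next
  case (Suc n)
  have "(real n + 1) * g (Suc n) > 0"
    unfolding g_Suc using Suc lam by (intro mult_pos_pos) auto
  then show ?case by (simp add: zero_less_mult_iff)
qed

text \<open>Since \<open>L\<close> sends G_{k+2} G_k to g_k, the square of the difference gives
  g_{k+2} - g_k; the recurrence for \<open>g\<close> then brings in the factor
  \<open>s\<close>.\<close>

lemma h_Suc: "X (Suc n) * h (Suc n) = 2 * s * (real n + 1 + lam) * g n"
proof (cases n)
  case 0
  then show ?thesis using g_Suc[of 0] by (simp add: s_def algebra_simps)
next
  case (Suc k)
  have "h (Suc (Suc k)) = g (Suc (Suc k)) - g k"
    by (simp only: gegdiff.simps left_diff_distrib right_diff_distrib L_diff L_G_G_Suc_Suc diff_self diff_0_right)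
  moreover have "(real k + 2) * g (Suc (Suc k)) = (real k + 3 + 2 * lam) * g (Suc k)"
    using g_Suc[of "Suc k"] by (simp add: algebra_simps)
  ultimately have "(real k + 2) * (real k + 2 + 2 * lam) * h (Suc (Suc k))
      = 2 * (2 * lam + 1) * (real k + 2 + lam) * g (Suc k)"
    using g_Suc[of k] by algebra
  then show ?thesis by (simp add: Suc s_def algebra_simps del: gegdiff.simps)
qed

lemma h_Suc_pos: "h (Suc n) > 0"
proof -
  have "X (Suc n) * h (Suc n) > 0"
    unfolding h_Suc using g_pos[of n] s_pos lam by (intro mult_pos_pos) auto
  moreover have "X (Suc n) > 0" using lam by (intro mult_pos_pos) auto
  ultimately show ?thesis using zero_less_mult_pos by blast
qed

section \<open>Bounds for the derivative\<close>

abbreviation d :: "nat \<Rightarrow> real" where "d i \<equiv> increment_poly s (real i + 1)"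

lemma d_eq: "d i = (real i + 1 + lam) * X (Suc i)"
  by (simp add: increment_poly_def s_def algebra_simps)

lemma d_pos: "d i > 0"
  unfolding d_eq using lam by (intro mult_pos_pos) auto

text \<open>\<open>2 * s * Z n\<close> will be the squared norm of the test polynomial of degree
  \<open>n\<close>, and the off-diagonal column sums of both matrices are multiples of
  \<open>Z n\<close>.\<close>

definition Z :: "nat \<Rightarrow> real" where "Z n = (\<Sum>i\<in>parity_below n. d i * g i)"

lemma Z_Suc_Suc: "Z (Suc (Suc n)) = Z n + d (Suc n) * g (Suc n)"
  by (simp add: Z_def)

lemma Z_Suc: "Z (Suc n) = g n * partial_sum_poly s (real n + 1)"
proof (induction n rule: induct_nat_012)
  case 0
  show ?case using partial_sum_poly_1[OF s_pos] by (simp add: Z_def)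
next
  case 1
  \<comment> \<open>At \<open>l = 0\<close> the right side of the step identity vanishes, so the
    partial sum and the increment agree at 2.\<close>
  show ?case using partial_sum_poly_step[OF s_pos, of 0] s_pos by (simp add: Z_def)
next
  case (ge2 n)
  let ?l = "real n + 1"
  have "?l * g (Suc n) = (?l + s) * g n" "(?l + 1) * g (Suc (Suc n)) = (?l + 1 + s) * g (Suc n)"
    using g_Suc[of n] g_Suc[of "Suc n"] by (simp_all add: s_def algebra_simps)
  moreover note partial_sum_poly_step[OF s_pos, of ?l]
  ultimately have "((?l + 1) * ?l) * (g n * partial_sum_poly s ?l)
      = ((?l + 1) * ?l) * (g (Suc (Suc n)) * (partial_sum_poly s (?l + 2) - increment_poly s (?l + 2)))"
    by algebra
  then have "g n * partial_sum_poly s ?l = g (Suc (Suc n)) * (partial_sum_poly s (?l + 2) - increment_poly s (?l + 2))"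
    by (simp add: add_nonneg_eq_0_iff)
  then show ?case
    using ge2(1) Z_Suc_Suc[of "Suc n"] by (simp add: algebra_simps)
qed

lemma Z_pos: "Z (Suc n) > 0"
  unfolding Z_def by (intro sum_pos mult_pos_pos d_pos g_pos) (auto simp: parity_below_def intro!: exI[of _ n])

lemma L_G_G_below:
  "i \<in> parity_below n \<Longrightarrow> L (G i * G (Suc n)) = g i"
  by (rule L_G_G) (auto simp: parity_below_def)

text \<open>The squared norm of the derivative of the test polynomial.\<close>

definition deriv_norm :: "nat \<Rightarrow> real" where
  "deriv_norm n = 4 * (\<Sum>i\<in>parity_below n. \<Sum>j\<in>parity_below n. d i * d j * L (G i * G j))"

text \<open>Each new off-diagonal entry involves only g_i, so the new column sums to
  \<open>d (Suc n) * Z n\<close>.\<close>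

lemma deriv_norm_Suc_Suc:
  "deriv_norm (Suc (Suc n))
     = deriv_norm n + 4 * d (Suc n) * (2 * Z (Suc (Suc n)) - d (Suc n) * g (Suc n))"
proof -
  have "(\<Sum>i\<in>parity_below n. d i * d (Suc n) * L (G i * G (Suc n))) = d (Suc n) * Z n"
    by (simp add: Z_def sum_distrib_left L_G_G_below mult_ac)
  then show ?thesis
    unfolding deriv_norm_def Z_Suc_Suc
    by (subst sum_sum_parity_below_Suc_Suc) (simp_all add: mult.commute algebra_simps)
qed

lemma deriv_norm_ge: "lower_poly s (real n) * Z n \<le> deriv_norm n"
proof (induction n rule: induct_nat_012)
  case 0
  show ?case by (simp add: Z_def deriv_norm_def)
next
  case 1
  \<comment> \<open>At \<open>l = 1\<close> the partial sum equals the increment, which removes the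
    term with \<open>lower_poly s (-1)\<close>.\<close>
  have "lower_poly s 1 * d 0 \<le> 4 * d 0 * d 0"
    using lower_poly_increment[OF s_pos, of 1] by (simp add: partial_sum_poly_1[OF s_pos])
  from mult_right_mono[OF this, of "g 0"] g_pos[of 0] show ?case
    by (simp add: Z_def deriv_norm_def mult_ac)
next
  case (ge2 n)
  let ?l = "real n + 2"
  have Z: "Z (Suc (Suc n)) = g (Suc n) * partial_sum_poly s ?l" and d: "d (Suc n) = increment_poly s ?l"
    using Z_Suc[of "Suc n"] by (simp_all add: add_ac)
  have Zn: "Z n = g (Suc n) * (partial_sum_poly s ?l - increment_poly s ?l)"
    using Z_Suc_Suc[of n] unfolding Z d by (simp add: algebra_simps)
  have "lower_poly s ?l * Z (Suc (Suc n)) - lower_poly s (real n) * Z n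
      = g (Suc n) * (lower_poly s ?l * partial_sum_poly s ?l
          - lower_poly s (?l - 2) * (partial_sum_poly s ?l - increment_poly s ?l))"
    unfolding Zn Z by (simp add: algebra_simps)
  also have "\<dots> \<le> g (Suc n) * (4 * increment_poly s ?l * (2 * partial_sum_poly s ?l - increment_poly s ?l))"
    using g_pos[of "Suc n"] by (intro mult_left_mono lower_poly_increment s_pos) auto
  also have "\<dots> = deriv_norm (Suc (Suc n)) - deriv_norm n"
    unfolding deriv_norm_Suc_Suc Z d by (simp add: algebra_simps)
  finally show ?case using ge2(1) by (simp add: add_ac)
qed

lemma exists_large_derivative:
  "\<exists>q. q \<noteq> 0 \<and> degree q \<le> Suc n \<and> L (q * q) > 0 \<and>
     lower_poly s (real (Suc n)) / (2 * s) * L (q * q) \<le> L (pderiv q * pderiv q)"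
proof -
  let ?A = "parity_below (Suc n)"
  \<comment> \<open>By \<open>h_Suc\<close>, the weights \<open>X (Suc i)\<close> turn the terms of
    the squared norm into \<open>2 * s * d i * g i\<close> and the coefficients of the derivative
    into \<open>2 * d i\<close>.\<close>
  define q where "q = (\<Sum>i\<in>?A. smult (X (Suc i)) (E (Suc i)))"
  have "L (q * q) = (\<Sum>i\<in>?A. \<Sum>j\<in>?A. X (Suc i) * X (Suc j) * L (E (Suc i) * E (Suc j)))"
    unfolding q_def by (rule L_square_sum)
  also have "\<dots> = (\<Sum>i\<in>?A. \<Sum>j\<in>?A. if j = i then X (Suc i) * X (Suc i) * h (Suc i) else 0)"
    by (intro sum.cong refl) (auto simp: E_orthogonal)
  also have "\<dots> = (\<Sum>i\<in>?A. X (Suc i) * X (Suc i) * h (Suc i))"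
    by simp
  also have "\<dots> = 2 * s * Z (Suc n)"
    unfolding Z_def sum_distrib_left 
  proof (rule sum.cong[OF refl])
    fix i
    have "X (Suc i) * X (Suc i) * h (Suc i) = X (Suc i) * (X (Suc i) * h (Suc i))"
      by (rule mult.assoc)
    also have "\<dots> = 2 * s * (d i * g i)"
      unfolding h_Suc d_eq by (simp only: mult_ac)
    finally show "X (Suc i) * X (Suc i) * h (Suc i) = 2 * s * (d i * g i)" .
  qed
  finally have qq: "L (q * q) = 2 * s * Z (Suc n)" .
  have "pderiv q = (\<Sum>i\<in>?A. smult (2 * d i) (G i))"
    unfolding q_def pderiv_sum
    by (intro sum.cong refl) (simp only: pderiv_smult pderiv_gegdiff d_eq smult_smult mult_ac)
  then have "L (pderiv q * pderiv q) = deriv_norm (Suc n)"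
    by (simp only: L_square_sum deriv_norm_def) (simp add: sum_distrib_left mult_ac)
  then have "lower_poly s (real (Suc n)) / (2 * s) * L (q * q) \<le> L (pderiv q * pderiv q)"
    using deriv_norm_ge[of "Suc n"] s_pos by (simp add: qq)
  moreover have pos: "L (q * q) > 0"
    using Z_pos[of n] s_pos by (simp add: qq)
  moreover have "q \<noteq> 0" using pos by auto
  moreover have "degree q \<le> Suc n"
    unfolding q_def
    by (intro degree_sum_le degree_smult_le[THEN order_trans] degree_gegdiff_le[THEN order_trans])
       (auto simp: parity_below_def)
  ultimately show ?thesis by blast
qed

text \<open>The derivative of the normalised E_{i+1} is \<open>kappa i\<close> times G_i.\<close>

definition kappa :: "nat \<Rightarrow> real" where
  "kappa i = 2 * (real i + 1 + lam) / sqrt (h (Suc i))"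

lemma kappa_sq: "(kappa i)\<^sup>2 = 2 / s * d i / g i"
proof -
  have X: "X (Suc i) > 0" using lam by (intro mult_pos_pos) auto
  have "(kappa i)\<^sup>2 = 4 * (real i + 1 + lam)\<^sup>2 / h (Suc i)"
    using h_Suc_pos[of i] by (simp only: kappa_def power_divide power_mult_distrib) simp
  also have "h (Suc i) = 2 * s * (real i + 1 + lam) * g i / X (Suc i)"
    using h_Suc[of i] X by (simp add: field_simps)
  also have "4 * (real i + 1 + lam)\<^sup>2 / \<dots> = 2 / s * d i / g i"
    using s_pos g_pos[of i] X lam unfolding d_eq by (simp add: divide_simps power2_eq_square)
  finally show ?thesis .
qed

definition frobenius_sq :: "nat \<Rightarrow> real" where
  "frobenius_sq n = (\<Sum>i\<in>parity_below n. \<Sum>j\<in>parity_below n. (kappa i * kappa j * L (G i * G j))\<^sup>2)"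

text \<open>By \<open>kappa_sq\<close>, a squared entry above the diagonal is
  \<open>4 / s^2 * d i * d j * g i / g j\<close>. It is linear in \<open>d i * g i\<close>, so a
  column again sums to a multiple of \<open>Z n\<close>, and the norms cancel.\<close>

lemma frobenius_sq_Suc_Suc:
  "frobenius_sq (Suc (Suc n)) = frobenius_sq n
     + 4 / s\<^sup>2 * (increment_poly s (real n + 2)
         * (2 * partial_sum_poly s (real n + 2) - increment_poly s (real n + 2)))"
proof -
  let ?d = "increment_poly s (real n + 2)" and ?g = "g (Suc n)"
  have d: "d (Suc n) = ?d" by (simp add: add_ac)
  have g: "?g > 0" by (rule g_pos)
  have "(\<Sum>i\<in>parity_below n. (kappa i * kappa (Suc n) * L (G i * G (Suc n)))\<^sup>2)
      = (\<Sum>i\<in>parity_below n. 4 / s\<^sup>2 * ?d / ?g * (d i * g i))"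
  proof (rule sum.cong[OF refl])
    fix i assume "i \<in> parity_below n"
    then show "(kappa i * kappa (Suc n) * L (G i * G (Suc n)))\<^sup>2 = 4 / s\<^sup>2 * ?d / ?g * (d i * g i)"
      using g_pos[of i] g s_pos d
      by (simp only: L_G_G_below power_mult_distrib kappa_sq) (simp add: power2_eq_square mult_ac)
  qed
  also have "\<dots> = 4 / s\<^sup>2 * ?d / ?g * Z n"
    by (simp add: Z_def sum_distrib_left)
  also have "Z n = ?g * (partial_sum_poly s (real n + 2) - ?d)"
    using Z_Suc_Suc[of n] Z_Suc[of "Suc n"] d by (simp add: algebra_simps)
  finally have off: "(\<Sum>i\<in>parity_below n. (kappa i * kappa (Suc n) * L (G i * G (Suc n)))\<^sup>2)
      = 4 / s\<^sup>2 * ?d * (partial_sum_poly s (real n + 2) - ?d)"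
    using g by simp
  have diag: "(kappa (Suc n) * kappa (Suc n) * L (G (Suc n) * G (Suc n)))\<^sup>2 = 4 / s\<^sup>2 * ?d * ?d"
    using g s_pos by (simp only: power_mult_distrib kappa_sq d) (simp add: power2_eq_square)
  show ?thesis
    unfolding frobenius_sq_def
    by (subst sum_sum_parity_below_Suc_Suc, simp add: mult.commute, unfold off diag)
       (simp add: diff_divide_distrib algebra_simps)
qed

lemma frobenius_sq_le: "frobenius_sq n \<le> (real n + 1/2 + 5/8 * s) ^ 8 / (4 * s\<^sup>2 * (s + 4))"
proof -
  define Y where "Y = (\<lambda>l. l + 1/2 + 5/8 * s)"
  have step: "4 / s\<^sup>2 * (increment_poly s l * (2 * partial_sum_poly s l - increment_poly s l))
      \<le> (Y l ^ 8 - Y (l - 2) ^ 8) / (4 * s\<^sup>2 * (s + 4))" if "l \<ge> 1" for l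
  proof -
    let ?A = "increment_poly s l * (2 * partial_sum_poly s l - increment_poly s l)"
    have "4 / s\<^sup>2 * ?A = 16 * (s + 4) * ?A / (4 * s\<^sup>2 * (s + 4))"
      using s_pos by (simp add: divide_simps)
    also have "\<dots> \<le> (Y l ^ 8 - Y (l - 2) ^ 8) / (4 * s\<^sup>2 * (s + 4))"
      using upper_poly_increment[OF s_pos that] s_pos unfolding Y_def by (intro divide_right_mono) auto
    finally show ?thesis .
  qed
  have "frobenius_sq n \<le> Y n ^ 8 / (4 * s\<^sup>2 * (s + 4))"
  proof (induction n rule: induct_nat_012)
    case 0
    show ?case using s_pos by (simp add: frobenius_sq_def)
  next
    case 1
    \<comment> \<open>The single entry has the form of the general increment because the partial sum
      and the increment agree at 1.\<close>
    have "frobenius_sq 1 = 4 / s\<^sup>2 * (increment_poly s 1 * (2 * partial_sum_poly s 1 - increment_poly s 1))"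
      using g_pos[of 0] s_pos kappa_sq[of 0] 
      by (simp add: frobenius_sq_def partial_sum_poly_1[OF s_pos] power_mult_distrib power2_eq_square)
    also have "\<dots> \<le> (Y 1 ^ 8 - Y (1 - 2) ^ 8) / (4 * s\<^sup>2 * (s + 4))"
      by (rule step) simp
    also have "\<dots> \<le> Y 1 ^ 8 / (4 * s\<^sup>2 * (s + 4))"
      using s_pos by (intro divide_right_mono) auto
    finally show ?case by simp
  next
    case (ge2 n)
    then show ?case using step[of "real n + 2"] unfolding frobenius_sq_Suc_Suc
      by (simp add: diff_divide_distrib add_ac)
  qed
  then show ?thesis by (simp add: Y_def)
qed

text \<open>In normalised coordinates the derivative norm is a quadratic form with one block per
  parity, and \<open>C\<close> bounds the Frobenius norm of both blocks.\<close>

lemma derivative_bound: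
  assumes "degree p \<le> Suc n"
  shows "L (pderiv p * pderiv p)
    \<le> (real (Suc n) + 1/2 + 5/8 * s) ^ 4 / (2 * s * sqrt (s + 4)) * L (p * p)"
proof -
  define C where "C = (real (Suc n) + 1/2 + 5/8 * s) ^ 4 / (2 * s * sqrt (s + 4))"
  have C0: "C \<ge> 0" using s_pos by (simp add: C_def)
  have C2: "C\<^sup>2 = (real (Suc n) + 1/2 + 5/8 * s) ^ 8 / (4 * s\<^sup>2 * (s + 4))"
    using s_pos by (simp add: C_def power_divide power_mult_distrib flip: power_mult)
  have frob: "frobenius_sq (Suc n) \<le> C\<^sup>2" "frobenius_sq n \<le> C\<^sup>2"
  proof -
    show "frobenius_sq (Suc n) \<le> C\<^sup>2" unfolding C2 by (rule frobenius_sq_le)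
    have "frobenius_sq n \<le> (real n + 1/2 + 5/8 * s) ^ 8 / (4 * s\<^sup>2 * (s + 4))" by (rule frobenius_sq_le)
    also have "\<dots> \<le> C\<^sup>2"
      unfolding C2 using s_pos by (intro divide_right_mono power_mono) auto
    finally show "frobenius_sq n \<le> C\<^sup>2" .
  qed
  obtain a where a: "p = (\<Sum>k\<le>Suc n. smult (a k) (E k))"
    using gegdiff_expansion[of lam p "Suc n"] assms lam by auto
  \<comment> \<open>Coordinates in the normalised basis; the constant term is left out, as its
    derivative is zero.\<close>
  define b where "b i = a (Suc i) * sqrt (h (Suc i))" for i
  have "pderiv p = (\<Sum>i\<le>n. smult (a (Suc i)) (pderiv (E (Suc i))))"
    unfolding a by (subst sum.atMost_Suc_shift) (simp add: pderiv_sum pderiv_add pderiv_smult del: gegdiff.simps(1))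
  also have "\<dots> = (\<Sum>i<Suc n. smult (b i * kappa i) (G i))"
  proof (rule sum.cong)
    fix i
    have "b i * kappa i = a (Suc i) * (2 * (real i + 1 + lam))"
      using h_Suc_pos[of i] by (simp add: b_def kappa_def)
    then show "smult (a (Suc i)) (pderiv (E (Suc i))) = smult (b i * kappa i) (G i)"
      by (simp only: pderiv_gegdiff smult_smult)
  qed (simp add: lessThan_Suc_atMost)
  finally have "L (pderiv p * pderiv p)
      = (\<Sum>i<Suc n. \<Sum>j<Suc n. b i * kappa i * (b j * kappa j) * L (G i * G j))"
    by (simp add: L_square_sum del: sum.lessThan_Suc)
  also have "\<dots> = (\<Sum>i<Suc n. \<Sum>j<Suc n. b i * b j * (kappa i * kappa j * L (G i * G j)))"
    by (simp only: mult_ac)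
  \<comment> \<open>Entries between opposite parities vanish, so the matrix is block
    diagonal.\<close>
  also have "\<dots> = (\<Sum>i\<in>parity_below (Suc n). \<Sum>j\<in>parity_below (Suc n). b i * b j * (kappa i * kappa j * L (G i * G j)))
      + (\<Sum>i\<in>parity_below n. \<Sum>j\<in>parity_below n. b i * b j * (kappa i * kappa j * L (G i * G j)))"
  proof -
    have "L (G i * G j) = 0" if "i \<in> parity_below (Suc n)" "j \<in> parity_below n" for i j
      using that by (intro L_G_G_odd) (auto simp: parity_below_def)
    moreover have "L (G i * G j) = 0" if "j \<in> parity_below (Suc n)" "i \<in> parity_below n" for i j
      using that by (intro L_G_G_odd) (auto simp: parity_below_def)
    ultimately show ?thesis
      unfolding parity_below_Un(1) by (simp add: sum.union_disjoint parity_below_Un(2))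
  qed
  also have "\<dots> \<le> C * (\<Sum>i\<in>parity_below (Suc n). (b i)\<^sup>2) + C * (\<Sum>i\<in>parity_below n. (b i)\<^sup>2)"
    using frob C0 unfolding frobenius_sq_def by (intro add_mono quadratic_form_le_frobenius)
  also have "\<dots> = C * (\<Sum>i<Suc n. (b i)\<^sup>2)"
    unfolding parity_below_Un(1) by (simp add: sum.union_disjoint parity_below_Un(2) distrib_left)
  also have "\<dots> \<le> C * L (p * p)"
  proof (rule mult_left_mono[OF _ C0])
    have "L (p * p) = (\<Sum>k\<le>Suc n. \<Sum>l\<le>Suc n. a k * a l * L (E k * E l))"
      unfolding a by (rule L_square_sum)
    also have "\<dots> = (\<Sum>k\<le>Suc n. \<Sum>l\<le>Suc n. if l = k then (a k)\<^sup>2 * h k else 0)"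
      by (intro sum.cong refl) (auto simp: E_orthogonal power2_eq_square)
    also have "\<dots> = (\<Sum>k\<le>Suc n. (a k)\<^sup>2 * h k)"
      by simp
    also have "\<dots> = (a 0)\<^sup>2 * h 0 + (\<Sum>i\<le>n. (b i)\<^sup>2)"
      using h_Suc_pos by (subst sum.atMost_Suc_shift) (simp add: b_def power_mult_distrib less_imp_le del: gegdiff.simps(1))
    \<comment> \<open>The contribution of E_0 is nonnegative and is discarded.\<close>
    finally show "(\<Sum>i<Suc n. (b i)\<^sup>2) \<le> L (p * p)"
      using L_1_pos by (simp add: lessThan_Suc_atMost)
  qed
  finally show ?thesis by (simp add: C_def)
qed

end

section \<open>The weighted integral\<close>

definition gegenbauer_integral :: "real \<Rightarrow> real poly \<Rightarrow> real" where
  "gegenbauer_integral lam p = (LBINT t:{-1<..<1}. gegenbauer_weight lam t * poly p t)"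

text \<open>The substitution u = (t + 1) / 2 turns u (1 - u) into (1 - t^2) / 4 and reduces the
  claim to the Beta integral.\<close>

lemma gegenbauer_weight_has_integral:
  fixes lam :: real
  assumes "lam > -1/2"
  shows "(gegenbauer_weight lam has_integral
           2 * 4 powr (lam - 1/2) * Beta (lam + 1/2) (lam + 1/2)) {-1<..<1}"
proof -
  have *: "(t / 2 + 1 / 2) powr (lam - 1/2) * (1 - (t / 2 + 1 / 2)) powr (lam - 1/2)
      = gegenbauer_weight lam t / 4 powr (lam - 1/2)" if "t \<in> {-1..1}" for t :: real
  proof -
    have "(t / 2 + 1 / 2) powr (lam - 1/2) * (1 - (t / 2 + 1 / 2)) powr (lam - 1/2)
        = ((t / 2 + 1 / 2) * (1 - (t / 2 + 1 / 2))) powr (lam - 1/2)"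
      using that by (subst powr_mult) auto
    also have "(t / 2 + 1 / 2) * (1 - (t / 2 + 1 / 2)) = (1 - t\<^sup>2) / 4"
      by (simp add: field_simps power2_eq_square)
    also have "\<dots> powr (lam - 1/2) = gegenbauer_weight lam t / 4 powr (lam - 1/2)"
      using that unfolding gegenbauer_weight_def
      by (subst powr_divide) (auto simp: abs_le_iff abs_square_le_1)
    finally show ?thesis .
  qed
  have "((\<lambda>t. t powr (lam + 1/2 - 1) * (1 - t) powr (lam + 1/2 - 1))
      has_integral Beta (lam + 1/2) (lam + 1/2)) (cbox 0 1)"
    using has_integral_Beta_real[of "lam + 1/2" "lam + 1/2"] assms by simp
  from has_integral_affinity'[OF this, of "1/2" "1/2"]
  have "((\<lambda>t. (t / 2 + 1 / 2) powr (lam - 1/2) * (1 - (t / 2 + 1 / 2)) powr (lam - 1/2))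
      has_integral 2 * Beta (lam + 1/2) (lam + 1/2)) {-1..1}"
    by simp
  then have "((\<lambda>t. gegenbauer_weight lam t / 4 powr (lam - 1/2))
      has_integral 2 * Beta (lam + 1/2) (lam + 1/2)) {-1..1}"
    by (rule has_integral_eq[rotated]) (use * in auto)
  from has_integral_mult_left[OF this, of "4 powr (lam - 1/2)"]
  show ?thesis by (simp add: has_integral_Icc_iff_Ioo mult_ac)
qed

lemma continuous_on_gegenbauer_weight: "continuous_on {-1<..<1} (gegenbauer_weight lam)"
  unfolding gegenbauer_weight_def
  by (intro continuous_intros) (auto simp: power2_eq_1_iff)

lemma gegenbauer_weight_set_integrable:
  assumes "lam > -1/2"
  shows "set_integrable lborel {-1<..<1} (gegenbauer_weight lam)"
proof -
  have "gegenbauer_weight lam absolutely_integrable_on {-1<..<1}"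
    using gegenbauer_weight_has_integral[OF assms]
    by (intro nonnegative_absolutely_integrable_1) (auto simp: gegenbauer_weight_def)
  then show ?thesis
    unfolding set_integrable_def
    \<comment> \<open>Passing from Lebesgue to Borel measure requires Borel measurability, which
      continuity on the open interval provides.\<close>
    by (subst (asm) integrable_completion)
       (use borel_measurable_continuous_on_indicator[OF _ continuous_on_gegenbauer_weight] in auto)
qed

text \<open>A polynomial is bounded on the compact interval, so a multiple of the weight
  dominates.\<close>

lemma gegenbauer_integrable:
  assumes "lam > -1/2"
  shows "set_integrable lborel {-1<..<1} (\<lambda>t. gegenbauer_weight lam t * poly p t)"
proof -
  have "bounded (poly p ` {-1..1})"
    by (intro compact_imp_bounded compact_continuous_image continuous_intros) auto
  then obtain B where B: "\<And>t. t \<in> {-1..1} \<Longrightarrow> \<bar>poly p t\<bar> \<le> B"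
    unfolding bounded_iff by (metis image_eqI real_norm_def)
  show ?thesis
  proof (rule set_integrable_bound)
    show "set_integrable lborel {-1<..<1} (\<lambda>t. gegenbauer_weight lam t * B)"
      using gegenbauer_weight_set_integrable[OF assms] by simp
    show "set_borel_measurable lborel {-1<..<1} (\<lambda>t. gegenbauer_weight lam t * poly p t)"
      unfolding set_borel_measurable_def measurable_lborel2
      by (intro borel_measurable_continuous_on_indicator continuous_intros
          continuous_on_gegenbauer_weight) auto
    show "AE t in lborel. t \<in> {-1<..<1} \<longrightarrow>
        norm (gegenbauer_weight lam t * poly p t) \<le> norm (gegenbauer_weight lam t * B)"
    proof (intro AE_I2 impI)
      fix t :: real assume "t \<in> {-1<..<1}"
      then have "\<bar>poly p t\<bar> \<le> \<bar>B\<bar>" using B[of t] by auto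
      then show "norm (gegenbauer_weight lam t * poly p t) \<le> norm (gegenbauer_weight lam t * B)"
        by (auto simp: abs_mult intro!: mult_left_mono)
    qed
  qed
qed

lemma gegenbauer_integral_add:
  "lam > -1/2 \<Longrightarrow> gegenbauer_integral lam (p + q) = gegenbauer_integral lam p + gegenbauer_integral lam q"
  using gegenbauer_integrable[of lam p] gegenbauer_integrable[of lam q]
  by (simp add: gegenbauer_integral_def distrib_left)

lemma gegenbauer_integral_smult:
  "gegenbauer_integral lam (smult c p) = c * gegenbauer_integral lam p"
  by (simp add: gegenbauer_integral_def mult.left_commute)

lemma gegenbauer_integral_1_pos:
  assumes "lam > -1/2"
  shows "gegenbauer_integral lam 1 > 0"
proof -
  have "gegenbauer_integral lam 1 = integral {-1<..<1} (gegenbauer_weight lam)"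
    unfolding gegenbauer_integral_def
    using set_borel_integral_eq_integral(2)[OF gegenbauer_weight_set_integrable[OF assms]] by simp
  also have "\<dots> = 2 * 4 powr (lam - 1/2) * Beta (lam + 1/2) (lam + 1/2)"
    using gegenbauer_weight_has_integral[OF assms] by (rule integral_unique)
  also have "\<dots> > 0"
    using assms by (auto simp: Beta_def intro!: mult_pos_pos divide_pos_pos Gamma_real_pos)
  finally show ?thesis .
qed

text \<open>The integrand is the derivative of \<open>F\<close>, which is zero at both endpoints and
  continuous there because \<open>lam + 1/2 > 0\<close>.\<close>

lemma gegenbauer_integral_by_parts:
  assumes "lam > -1/2"
  shows "gegenbauer_integral lam ([:1, 0, -1:] * pderiv f - smult (2 * lam + 1) ([:0, 1:] * f)) = 0"
proof -
  define F where "F = (\<lambda>t. (1 - t\<^sup>2) powr (lam + 1/2) * poly f t)"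
  let ?p = "[:1, 0, -1:] * pderiv f - smult (2 * lam + 1) ([:0, 1:] * f)"
  let ?w = "\<lambda>t. gegenbauer_weight lam t * poly ?p t"
  have contF: "continuous_on {-1..1} F"
    unfolding F_def using assms
    by (intro continuous_intros continuous_on_powr') (auto simp: abs_le_iff abs_square_le_1)
  have "(LBINT t=ereal (-1)..ereal 1. ?w t) = F 1 - F (-1)"
  proof (rule interval_integral_FTC_integrable)
    fix t :: real assume "ereal (-1) < ereal t" "ereal t < ereal 1"
    then have t: "-1 < t" "t < 1" by auto
    then have t2: "1 - t\<^sup>2 > 0" by (simp add: abs_square_less_1 abs_less_iff)
    have *: "(1 - t\<^sup>2) powr (lam + 1/2) = (1 - t\<^sup>2) powr (lam - 1/2) * (1 - t\<^sup>2)"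
      using t2 powr_add[of "1 - t\<^sup>2" "lam - 1/2" 1] by (simp add: add.commute)
    have "(F has_real_derivative (lam + 1/2) * (1 - t\<^sup>2) powr (lam + 1/2 - 1) * (- (2 * t)) * poly f t
        + (1 - t\<^sup>2) powr (lam + 1/2) * poly (pderiv f) t) (at t)"
      unfolding F_def using t2 by (auto intro!: derivative_eq_intros)
    moreover have "(lam + 1/2) * (1 - t\<^sup>2) powr (lam + 1/2 - 1) * (- (2 * t)) * poly f t
        + (1 - t\<^sup>2) powr (lam + 1/2) * poly (pderiv f) t = ?w t"
      unfolding * by (simp add: gegenbauer_weight_def algebra_simps power2_eq_square)
    ultimately show "(F has_vector_derivative ?w t) (at t)"
      by (simp add: has_real_derivative_iff_has_vector_derivative[symmetric])
    show "isCont ?w t"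
      using t continuous_on_gegenbauer_weight[of lam]
      by (intro continuous_intros) (auto simp: continuous_on_eq_continuous_at)
  next
    show "set_integrable lborel (einterval (ereal (-1)) (ereal 1)) ?w"
      unfolding einterval_eq using assms by (rule gegenbauer_integrable)
    show "((F \<circ> real_of_ereal) \<longlongrightarrow> F (-1)) (at_right (ereal (-1)))"
      using contF by (simp add: ereal_tendsto_simps continuous_on_Icc_at_rightD)
    show "((F \<circ> real_of_ereal) \<longlongrightarrow> F 1) (at_left (ereal 1))"
      using contF by (simp add: ereal_tendsto_simps continuous_on_Icc_at_leftD)
  qed simp
  then show ?thesis
    by (simp add: gegenbauer_integral_def interval_lebesgue_integral_def F_def)
qed

lemma gegenbauer_functional_integral:
  assumes "lam > -1/2"
  shows "gegenbauer_functional lam (gegenbauer_integral lam)"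
  using assms
  by unfold_locales
    (simp_all only: gegenbauer_integral_add gegenbauer_integral_smult gegenbauer_integral_1_pos
      gegenbauer_integral_by_parts)

section \<open>From the integral to the Markov constant\<close>

lemma wnorm_poly: "wnorm lam (poly p) = sqrt (gegenbauer_integral lam (p * p))"
  by (simp add: wnorm_def gegenbauer_integral_def power2_eq_square)

lemma gegenbauer_integral_square_nonneg: "gegenbauer_integral lam (p * p) \<ge> 0"
  unfolding gegenbauer_integral_def set_lebesgue_integral_def
  by (intro Bochner_Integration.integral_nonneg) (simp add: gegenbauer_weight_def)

theorem theorem1p1:
  fixes n :: nat and lam :: real
  assumes "n \<ge> 3" and "lam > -1/2"
  shows "(real n + 1) * (real n + lam + 1/2)\<^sup>2 * (real n + 2 * lam)
           / ((2 * lam + 1) * (2 * lam + 5)) \<le> (markov_const n lam)\<^sup>2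
       \<and> (markov_const n lam)\<^sup>2 \<le>
           (real n + 5/4 * lam + 9/8) ^ 4 / (2 * (2 * lam + 1) * sqrt (2 * lam + 5))"
proof -
  interpret gegenbauer_functional lam "gegenbauer_integral lam"
    using assms(2) by (rule gegenbauer_functional_integral)
  obtain m where n: "n = Suc m" using assms(1) by (cases n) auto
  define ratio where "ratio p = wnorm lam (poly (pderiv p)) / wnorm lam (poly p)" for p
  define S where "S = {p :: real poly. p \<noteq> 0 \<and> degree p \<le> n}"
  define U where "U = (real n + 1/2 + 5/8 * s) ^ 4 / (2 * s * sqrt (s + 4))"
  have U: "U = (real n + 5/4 * lam + 9/8) ^ 4 / (2 * (2 * lam + 1) * sqrt (2 * lam + 5))"
  proof -
    have "real n + 1/2 + 5/8 * s = real n + 5/4 * lam + 9/8" "s + 4 = 2 * lam + 5"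
      by (simp_all add: s_def field_simps)
    then show ?thesis by (simp only: U_def s_def)
  qed
  have U0: "U \<ge> 0" using s_pos by (simp add: U_def)
  have ratio_sq: "(ratio p)\<^sup>2
      = gegenbauer_integral lam (pderiv p * pderiv p) / gegenbauer_integral lam (p * p)" for p
    by (simp add: ratio_def wnorm_poly power_divide gegenbauer_integral_square_nonneg)
  have ratio_nonneg: "ratio p \<ge> 0" for p
    by (simp add: ratio_def wnorm_poly gegenbauer_integral_square_nonneg)
  have ratio_le: "ratio p \<le> sqrt U" if "p \<in> S" for p
  proof (rule real_le_rsqrt)
    have "gegenbauer_integral lam (pderiv p * pderiv p) \<le> U * gegenbauer_integral lam (p * p)"
      using derivative_bound[of p m] that unfolding S_def U_def n by auto
    then show "(ratio p)\<^sup>2 \<le> U"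
      unfolding ratio_sq using U0 gegenbauer_integral_square_nonneg[of lam p]
      \<comment> \<open>For a zero denominator the quotient is 0 by convention, and
        \<open>U >= 0\<close> covers it.\<close>
      by (cases "gegenbauer_integral lam (p * p) = 0") (auto simp: divide_le_eq)
  qed
  obtain q where q: "q \<in> S" "gegenbauer_integral lam (q * q) > 0"
    "lower_poly s (real n) / (2 * s) * gegenbauer_integral lam (q * q)
      \<le> gegenbauer_integral lam (pderiv q * pderiv q)"
    using exists_large_derivative[of m] unfolding S_def n by auto
  have markov: "markov_const n lam = (SUP p\<in>S. ratio p)"
    by (simp add: markov_const_def S_def ratio_def)
  \<comment> \<open>The real supremum bounds its members only once the set is known to be bounded
    above.\<close>
  have "bdd_above (ratio ` S)"
    using ratio_le by (intro bdd_aboveI2)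
  then have le: "ratio q \<le> markov_const n lam"
    unfolding markov using q(1) by (intro cSUP_upper)
  have "markov_const n lam \<le> sqrt U"
    unfolding markov using q(1) ratio_le by (intro cSUP_least) auto
  \<comment> \<open>Squaring needs a nonnegative constant; this follows from \<open>ratio q\<close>,
    which lies below it.\<close>
  then have "(markov_const n lam)\<^sup>2 \<le> (sqrt U)\<^sup>2"
    using le ratio_nonneg[of q] by (intro power_mono) auto
  then have upper: "(markov_const n lam)\<^sup>2 \<le> U"
    using U0 by simp
  have "(real n + 1) * (real n + lam + 1/2)\<^sup>2 * (real n + 2 * lam) / ((2 * lam + 1) * (2 * lam + 5))
      = lower_poly s (real n) / (2 * s)"
  proof -
    have "real n + s / 2 = real n + lam + 1/2" "real n + s - 1 = real n + 2 * lam"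
      "s + 4 = 2 * lam + 5" "2 * lam + 1 = s"
      by (simp_all add: s_def field_simps)
    then show ?thesis using s_pos
      by (simp only: lower_poly_def, simp add: divide_simps) (simp add: algebra_simps)
  qed
  also have "\<dots> \<le> (ratio q)\<^sup>2"
    unfolding ratio_sq using q(2,3) by (simp add: le_divide_eq)
  also have "\<dots> \<le> (markov_const n lam)\<^sup>2"
    using le ratio_nonneg[of q] by (intro power_mono)
  finally show ?thesis using upper U by simp
qed

end
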